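(* Let $\gamma,\beta,r,\lambda\in\mathbb{N}_0$ and $\alpha\in\mathbb{N}$ with $\alpha\mid\beta$ and $\alpha\mid\gamma$. Then for every integer $n\ge 0$, $$\mathcal{B}^{r,x}_{n,\lambda}(\alpha,\beta,\gamma)=\sum_{\lambda_1+\lambda_2+\cdots+\lambda_{\lambda+1}=n}\binom{n}{\lambda_1,\lambda_2,\ldots,\lambda_{\lambda+1}}(\gamma|\alpha)_{\lambda_{\lambda+1}}\prod_{j=1}^{\lambda}\mathcal{B}^{r,x}_{\lambda_j,1}(\alpha,\beta,0),$$ where the sum runs over all $(\lambda+1)$-tuples $(\lambda_1,\ldots,\lambda_{\lambda+1})$ of nonnegative integers with sum $n$.
   Context: $\mathbb{N}$ is the set of positive integers and $\mathbb{N}_0=\mathbb{N}\cup\{0\}$; $x$ is a variable (when a nonnegative integer, a number of colours); $0^0=1$ and empty products equal $1$; $\binom{n}{\lambda_1,\ldots,\lambda_{\lambda+1}}$ is the multinomial coefficient. Factorial polynomials: $(t|\alpha)_n=\prod_{j=0}^{n-1}(t-j\alpha)$, with $(t|\alpha)_0=1$. Powers such as $(1+\alpha t)^{c/\alpha}$ denote the formal power series $\sum_{n\ge0}(c|\alpha)_n\,t^n/n!$. The numbers $\mathcal{B}^{r,x}_{n,\lambda}(\alpha,\beta,\gamma)$ are defined by the formal power series identity $$\sum_{n=0}^{\infty}\mathcal{B}^{r,x}_{n,\lambda}(\alpha,\beta,\gamma)\frac{t^n}{n!}=(1+\alpha t)^{\gamma/\alpha}\,\frac{u(t)^{r\lambda}\exp(-\lambda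 u(t))}{(1-u(t))^{(r+1)\lambda}},\qquad u(t)=x\big((1+\alpha t)^{\beta/\alpha}-1\big).$$ *)

theory Defs
  imports "HOL-Computational_Algebra.Formal_Power_Series"
begin

unbundle fps_syntax

definition factorial_poly :: "'a::comm_ring_1 \<Rightarrow> 'a \<Rightarrow> nat \<Rightarrow> 'a" where
  "factorial_poly t \<alpha> n = (\<Prod>j<n. t - of_nat j * \<alpha>)"

text \<open>The formal power series denoted by \<open>(1 + \<alpha>t)\<close> to the power \<open>c/\<alpha>\<close>.\<close>

definition gen_power :: "'a::field_char_0 \<Rightarrow> 'a \<Rightarrow> 'a fps" where
  "gen_power \<alpha> c = Abs_fps (\<lambda>n. factorial_poly c \<alpha> n / fact n)"

definition u_series :: "'a::field_char_0 \<Rightarrow> 'a \<Rightarrow> 'a \<Rightarrow> 'a fps" where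
  "u_series x \<alpha> \<beta> = fps_const x * (gen_power \<alpha> \<beta> - 1)"

text \<open>
  \<^const>\<open>u_series\<close> has zero constant coefficient (lemma below), so substituting it into
  \<open>exp(-lt)\<close> is meaningful and the denominator is a unit of the power series ring.
  The exponent written \<open>\<lambda>\<close> in the mathematics is called \<open>l\<close>.
\<close>

definition B_egf ::
  "nat \<Rightarrow> 'a::field_char_0 \<Rightarrow> nat \<Rightarrow> 'a \<Rightarrow> 'a \<Rightarrow> 'a \<Rightarrow> 'a fps" where
  "B_egf r x l \<alpha> \<beta> \<gamma> =
     (let u = u_series x \<alpha> \<beta> in
      gen_power \<alpha> \<gamma> *
        ((u ^ (r * l) * (fps_exp (- of_nat l) oo u)) / (1 - u) ^ ((r + 1) * l)))"

definition B_num ::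
  "nat \<Rightarrow> 'a::field_char_0 \<Rightarrow> nat \<Rightarrow> nat \<Rightarrow> 'a \<Rightarrow> 'a \<Rightarrow> 'a \<Rightarrow> 'a" where
  "B_num r x n l \<alpha> \<beta> \<gamma> = fact n * (B_egf r x l \<alpha> \<beta> \<gamma> $ n)"

text \<open>Only used with \<open>sum_list ks = n\<close>, where the division is exact.\<close>

definition multinomial :: "nat \<Rightarrow> nat list \<Rightarrow> nat" where
  "multinomial n ks = fact n div (\<Prod>k\<leftarrow>ks. fact k)"

lemma u_series_nth_0: "u_series x \<alpha> \<beta> $ 0 = 0"
  by (simp add: u_series_def gen_power_def factorial_poly_def)

lemma B_num_egf: "Abs_fps (\<lambda>n. B_num r x n l \<alpha> \<beta> \<gamma> / fact n) = B_egf r x l \<alpha> \<beta> \<gamma>"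
  by (simp add: fps_eq_iff B_num_def)

end

theory Submission
  imports Defs
begin

text \<open>The exponents r l, -l and (r+1) l in the generating function are all multiples of l, so
  the part depending on u is the l-th power of its own l = 1 instance E, while
  \<open>gen_power\<close> \<alpha> \<gamma> stands apart as one further factor G
  (\<open>B_egf_eq_power\<close>). Comparing coefficients in the product of l copies of E and one G
  gives a sum over (l+1)-tuples with sum n. Passing from ordinary to exponential coefficients
  multiplies each term by n! over the product of the factorials of the parts, which is the
  multinomial coefficient (\<open>of_nat_multinomial\<close>).\<close>

lemma prod_list_fact_dvd: "(\<Prod>k\<leftarrow>ks. fact k) dvd (fact (sum_list ks) :: nat)"
proof (induction ks)
  case (Cons k ks)
  have "fact k * (\<Prod>k\<leftarrow>ks. fact k) dvd (fact k * fact (sum_list ks) :: nat)"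
    using Cons.IH by (simp add: mult_dvd_mono)
  also have "\<dots> dvd fact (k + sum_list ks)"
    by (rule fact_fact_dvd_fact)
  finally show ?case by simp
qed simp

text \<open>Since the natural division in \<open>multinomial\<close> is exact by
  \<open>prod_list_fact_dvd\<close>, it becomes field division. The denominator is indexed by
  positions to match the products of coefficients in the main proof.\<close>

lemma of_nat_multinomial:
  assumes "sum_list ks = n"
  shows "(of_nat (multinomial n ks) :: 'a::field_char_0) = fact n / (\<Prod>j<length ks. fact (ks ! j))"
proof -
  have "(of_nat (multinomial n ks) :: 'a) = fact n / of_nat (\<Prod>k\<leftarrow>ks. fact k)"
  proof -
    have "multinomial n ks * (\<Prod>k\<leftarrow>ks. fact k) = fact n"
      using prod_list_fact_dvd[of ks] assms by (simp add: multinomial_def)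
    then have "of_nat (multinomial n ks) * of_nat (\<Prod>k\<leftarrow>ks. fact k) = (fact n :: 'a)"
      by (metis of_nat_fact of_nat_mult)
    moreover have "(\<Prod>k\<leftarrow>ks. fact k) \<noteq> (0 :: nat)"
      by (auto simp: prod_list_zero_iff)
    ultimately show ?thesis
      by (metis nonzero_eq_divide_eq of_nat_eq_0_iff)
  qed
  also have "(\<Prod>k\<leftarrow>ks. fact k) = (\<Prod>j<length ks. fact (ks ! j) :: nat)"
    by (simp add: prod.list_conv_set_nth atLeast0LessThan)
  finally show ?thesis by simp
qed

lemma gen_power_0: "gen_power \<alpha> 0 = 1"
proof (rule fps_ext)
  fix n
  show "gen_power \<alpha> 0 $ n = 1 $ n"
    by (cases n) (auto simp: gen_power_def factorial_poly_def prod.lessThan_Suc_shift)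
qed

text \<open>Setting \<gamma> = 0 removes the binomial factor by \<open>gen_power_0\<close>; what
  remains is multiplicative in l. For the exponential this uses that substituting u, which has zero
  constant term, commutes with powers.\<close>

lemma B_egf_eq_power: "B_egf r x l \<alpha> \<beta> \<gamma> = gen_power \<alpha> \<gamma> * B_egf r x 1 \<alpha> \<beta> 0 ^ l"
proof -
  define u where "u = u_series x \<alpha> \<beta>"
  have u0: "u $ 0 = 0"
    by (simp add: u_def u_series_nth_0)
  have e: "fps_exp (- of_nat l) oo u = (fps_exp (- 1) oo u) ^ l"
    using fps_compose_power[OF u0, of "fps_exp (- 1)" l] by (simp add: fps_exp_power_mult)
  \<comment> \<open>As 1 - u has constant term 1, it is a unit; without quotients the claim reduces
    to laws of exponents.\<close>
  have div: "a / (1 - u) ^ m = a * inverse (1 - u) ^ m" for a m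
    using u0 by (simp add: fps_divide_unit fps_inverse_power)
  show ?thesis
    unfolding B_egf_def Let_def u_def[symmetric] div e gen_power_0
    by (simp add: power_mult_distrib power_add algebra_simps flip: power_mult)
qed

theorem theorem3p2:
  fixes \<alpha> \<beta> \<gamma> r l n :: nat
    and x :: "'a::field_char_0"
  assumes "\<alpha> > 0"
    and "\<alpha> dvd \<beta>"
    and "\<alpha> dvd \<gamma>"
  shows "B_num r x n l (of_nat \<alpha>) (of_nat \<beta>) (of_nat \<gamma>) =
    (\<Sum>ks \<in> {ks :: nat list. length ks = l + 1 \<and> sum_list ks = n}.
       of_nat (multinomial n ks) * factorial_poly (of_nat \<gamma>) (of_nat \<alpha>) (ks ! l) *
       (\<Prod>j<l. B_num r x (ks ! j) 1 (of_nat \<alpha>) (of_nat \<beta>) 0))"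
proof -
  define G where "G = gen_power (of_nat \<alpha> :: 'a) (of_nat \<gamma>)"
  define E where "E = B_egf r x 1 (of_nat \<alpha>) (of_nat \<beta>) 0"
  \<comment> \<open>G sits at the last position l, matching the entry \<open>ks ! l\<close> that
    feeds the factorial polynomial.\<close>
  define a where "a = (\<lambda>j. if j < l then E else G)"
  \<comment> \<open>A general f lets the same splitting serve for the product of the series and for
    the product of their coefficients.\<close>
  have prod_a: "(\<Prod>j\<in>{0..l}. f (a j) j) = (\<Prod>j<l. f E j) * f G l" for f :: "'a fps \<Rightarrow> nat \<Rightarrow> 'b::comm_monoid_mult"
    by (simp add: a_def atLeast0AtMost flip: lessThan_Suc_atMost)
  have "B_num r x n l (of_nat \<alpha>) (of_nat \<beta>) (of_nat \<gamma>) = fact n * (\<Prod>j\<in>{0..l}. a j) $ n"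
    unfolding B_num_def B_egf_eq_power[of r x l]
    by (simp add: prod_a[of "\<lambda>b _. b"] G_def E_def mult.commute)
  also have "\<dots> = (\<Sum>ks\<in>natpermute n (l + 1). fact n * (\<Prod>j\<in>{0..l}. a j $ (ks ! j)))"
    by (simp add: fps_prod_nth sum_distrib_left)
  also have "\<dots> = (\<Sum>ks \<in> natpermute n (l + 1).
       of_nat (multinomial n ks) * factorial_poly (of_nat \<gamma>) (of_nat \<alpha>) (ks ! l) *
       (\<Prod>j<l. B_num r x (ks ! j) 1 (of_nat \<alpha>) (of_nat \<beta>) 0))"
  proof (rule sum.cong)
    fix ks assume "ks \<in> natpermute n (l + 1)"
    then have len: "length ks = Suc l" and sum: "sum_list ks = n"
      by (auto simp: natpermute_def)
    show "fact n * (\<Prod>j\<in>{0..l}. a j $ (ks ! j)) =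
      of_nat (multinomial n ks) * factorial_poly (of_nat \<gamma>) (of_nat \<alpha>) (ks ! l) *
       (\<Prod>j<l. B_num r x (ks ! j) 1 (of_nat \<alpha>) (of_nat \<beta>) 0)"
      \<comment> \<open>Of the l+1 factorials in the denominator, the last belongs to the
        coefficient of G and the others cancel those in \<open>B_num_def\<close>.\<close>
      by (simp add: of_nat_multinomial[OF sum] len prod_a[of "\<lambda>b j. b $ (ks ! j)"]
          B_num_def prod.distrib G_def gen_power_def E_def)
  qed simp
  finally show ?thesis
    by (simp add: natpermute_def)
qed

end
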